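(* Consider the affine game $\operatorname{AG}(X,P,G)$ where $X,P\in\mathbb{R}^m$ and $G\in\mathbb{R}^{m\times m}$ is a $\mathcal{K}^\dagger$-matrix. Suppose that the column sums of $G$ are non-negative, that is, $$\sum_{i\in\mathcal{M}}G_{ij}\geq 0\quad\text{for all } j\in\mathcal{M}.$$ Then for any $\mathcal{N}\subseteq\mathcal{M}$, the coalition value $V^*_{\mathcal{N}}$ exists and is additive, in the sense that $V^*_{\mathcal{N}}=\sum_{i\in\mathcal{N}}V^*_i$.
   Context: A real square matrix $M$ is a $\mathcal{P}^\dagger$-matrix if its determinant is non-negative and all its proper principal minors are positive. It is a $\mathcal{Z}$-matrix if all its off-diagonal entries are non-positive. It is a $\mathcal{K}^\dagger$-matrix if it is both a $\mathcal{P}^\dagger$-matrix and a $\mathcal{Z}$-matrix. Affine game (singular $G$ allowed). Let $\mathcal{M}=\{1,\dots,m\}$ be the set of players, and let $G\in\mathbb{R}^{m\times m}$ have a positive diagonal and non-zero proper principal minors ($\det G=0$ is allowed). In $\operatorname{AG}(X,P,G)$ each player $i$ chooses $s^i\in\mathcal{S}^i=\{0,1\}$ ($0$ = exercise, $1$ = not exercise). The set of (pure) strategy profiles is $\mathcal{S}=\{0,1\}^m$. For $s\in\mathcal{S}$ let $\mathcal{E}(s)=\{i\in\mathcal{M}:s^i=0\}$. The payoffs are $$V_i(s)=\begin{cases}X_i,& i\in\mathcal{E}(s),\\ P_i+G_{i\,\mathcal{E}(s)}\big(G_{\mathcal{E}(s)\mathcal{E}(s)}\big)^{-1}\big(X_{\mathcal{E}(s)}-P_{\mathcal{E}(s)}\big),&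 i\notin\mathcal{E}(s),\end{cases}$$ where $G_{i\,\mathcal{E}}$ is the part of row $i$ of $G$ with column indices in $\mathcal{E}$, $G_{\mathcal{E}\mathcal{E}}$ is the principal sub-matrix indexed by $\mathcal{E}$, and $X_{\mathcal{E}},P_{\mathcal{E}}$ are sub-vectors; if $\mathcal{E}(s)=\emptyset$ then $V(s)=P$. For $\mathcal{N}\subseteq\mathcal{M}$ put $V_{\mathcal{N}}(s)=\sum_{i\in\mathcal{N}}V_i(s)$ and write $s=(s^{\mathcal{N}},s^{-\mathcal{N}})$ with $s^{\mathcal{N}}\in\mathcal{S}^{\mathcal{N}}=\prod_{i\in\mathcal{N}}\mathcal{S}^i$ and $s^{-\mathcal{N}}\in\mathcal{S}^{-\mathcal{N}}=\prod_{i\notin\mathcal{N}}\mathcal{S}^i$. The coalition value is $$V^*_{\mathcal{N}}:=\sup_{s^{\mathcal{N}}\in\mathcal{S}^{\mathcal{N}}}\inf_{s^{-\mathcal{N}}\in\mathcal{S}^{-\mathcal{N}}}V_{\mathcal{N}}(s^{\mathcal{N}},s^{-\mathcal{N}})=\inf_{s^{-\mathcal{N}}\in\mathcal{S}^{-\mathcal{N}}}\sup_{s^{\mathcal{N}}\in\mathcal{S}^{\mathcal{N}}}V_{\mathcal{N}}(s^{\mathcal{N}},s^{-\mathcal{N}}),$$ and it is said to exist if the second equality holds. $V^*_i$ denotes the value for the single player $i$ (i.e. $\mathcal{N}=\{i\}$); when $G$ is a $\mathcal{K}^\dagger$-matrix these individual values exist. *)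

theory Defs
  imports
    "HOL-Library.FuncSet"
    "Jordan_Normal_Form.Determinant"
    "Jordan_Normal_Form.Gauss_Jordan_Elimination"
    "Jordan_Normal_Form.DL_Submatrix"
begin

(* Following the indexing of the matrix library, the players are 0, ..., m - 1. *)

section \<open>Matrix classes\<close>

definition P_dagger_matrix :: "real mat \<Rightarrow> bool" where
  "P_dagger_matrix M \<longleftrightarrow>
     square_mat M \<and> det M \<ge> 0 \<and>
     (\<forall>E. E \<noteq> {} \<longrightarrow> E \<subset> {..<dim_row M} \<longrightarrow> det (submatrix M E E) > 0)"

definition Z_matrix :: "real mat \<Rightarrow> bool" where
  "Z_matrix M \<longleftrightarrow>
     square_mat M \<and>
     (\<forall>i<dim_row M. \<forall>j<dim_row M. i \<noteq> j \<longrightarrow> M $$ (i, j) \<le> 0)"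

definition K_dagger_matrix :: "real mat \<Rightarrow> bool" where
  "K_dagger_matrix M \<longleftrightarrow> P_dagger_matrix M \<and> Z_matrix M"

section \<open>Affine games\<close>

definition affine_game :: "nat \<Rightarrow> real vec \<Rightarrow> real vec \<Rightarrow> real mat \<Rightarrow> bool" where
  "affine_game m X P G \<longleftrightarrow>
     X \<in> carrier_vec m \<and> P \<in> carrier_vec m \<and> G \<in> carrier_mat m m \<and>
     (\<forall>i<m. G $$ (i, i) > 0) \<and>
     (\<forall>E. E \<noteq> {} \<longrightarrow> E \<subset> {..<m} \<longrightarrow> det (submatrix G E E) \<noteq> 0)"

(* pick E k is the k-th smallest element of E, so that the entries of subvec are
   ordered consistently with those of submatrix. *)
definition subvec :: "'a vec \<Rightarrow> nat set \<Rightarrow> 'a vec" where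
  "subvec v E = vec (card {i. i < dim_vec v \<and> i \<in> E}) (\<lambda>k. v $ pick E k)"

(* Strategy 0 means exercise, 1 means not exercise. *)
definition strategies :: "nat set \<Rightarrow> (nat \<Rightarrow> nat) set" where
  "strategies N = (\<Pi>\<^sub>E i\<in>N. {0, 1})"

definition exercise_set :: "nat \<Rightarrow> (nat \<Rightarrow> nat) \<Rightarrow> nat set" where
  "exercise_set m s = {i. i < m \<and> s i = 0}"

(* The inverse is only evaluated at a non-empty proper subset E of the players (some i is
   not in E), where the principal submatrix of an affine game is invertible; in particular
   G itself is never inverted. *)
definition payoff ::
  "nat \<Rightarrow> real vec \<Rightarrow> real vec \<Rightarrow> real mat \<Rightarrow> (nat \<Rightarrow> nat) \<Rightarrow> nat \<Rightarrow> real" where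
  "payoff m X P G s i =
     (let E = exercise_set m s in
      if i \<in> E then X $ i
      else if E = {} then P $ i
      else P $ i + subvec (row G i) E \<bullet>
             (the (mat_inverse (submatrix G E E)) *\<^sub>v (subvec X E - subvec P E)))"

definition coalition_payoff ::
  "nat \<Rightarrow> real vec \<Rightarrow> real vec \<Rightarrow> real mat \<Rightarrow> nat set \<Rightarrow> (nat \<Rightarrow> nat) \<Rightarrow> real" where
  "coalition_payoff m X P G N s = (\<Sum>i\<in>N. payoff m X P G s i)"

definition combine :: "nat set \<Rightarrow> (nat \<Rightarrow> nat) \<Rightarrow> (nat \<Rightarrow> nat) \<Rightarrow> nat \<Rightarrow> nat" where
  "combine N a b = (\<lambda>i. if i \<in> N then a i else b i)"

section \<open>Coalition values\<close>

(* All strategy sets are finite and non-empty, so these real suprema and infima are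
   genuine maxima and minima. *)
definition lower_value ::
  "nat \<Rightarrow> real vec \<Rightarrow> real vec \<Rightarrow> real mat \<Rightarrow> nat set \<Rightarrow> real" where
  "lower_value m X P G N =
     (SUP a\<in>strategies N. INF b\<in>strategies ({..<m} - N).
        coalition_payoff m X P G N (combine N a b))"

definition upper_value ::
  "nat \<Rightarrow> real vec \<Rightarrow> real vec \<Rightarrow> real mat \<Rightarrow> nat set \<Rightarrow> real" where
  "upper_value m X P G N =
     (INF b\<in>strategies ({..<m} - N). SUP a\<in>strategies N.
        coalition_payoff m X P G N (combine N a b))"

definition coalition_value_exists ::
  "nat \<Rightarrow> real vec \<Rightarrow> real vec \<Rightarrow> real mat \<Rightarrow> nat set \<Rightarrow> bool" where
  "coalition_value_exists m X P G N \<longleftrightarrow> lower_value m X P G N = upper_value m X P G N"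

(* Meaningful only when coalition_value_exists holds. *)
definition coalition_value ::
  "nat \<Rightarrow> real vec \<Rightarrow> real vec \<Rightarrow> real mat \<Rightarrow> nat set \<Rightarrow> real" where
  "coalition_value m X P G N = lower_value m X P G N"

end

theory Submission
  imports Defs
begin

text \<open>
  If the players in a proper subset E exercise, the payoffs are P + G y, where y vanishes off E and
  (G y) = X - P on E. Proper principal submatrices of G are inverse positive, so a vector d with
  d \<le> 0 off F and G d \<le> 0 on F satisfies d \<le> 0. Take E to be a maximal proper set with y \<ge> 0.
  Either P + G y \<ge> X, or E misses a single player, who prefers to exercise too; then let everybody
  exercise. Comparing the resulting profile with any other one, the difference d of the
  y-vectors is non-positive (up to a multiple of a Schur complement vector in the second case).
  The sign pattern of G then shows that players who keep their strategies do not lose, and the column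
  sums show that the total payoff does not increase. The first fact bounds
  each coalition from below; together with the second, applied to the complement, it bounds each
  coalition from above by the same sum of individual payoffs.
\<close>

section \<open>Principal submatrices indexed by subsets\<close>

lemma card_index_subset:
  assumes "E \<subseteq> {..<m::nat}"
  shows "card {i. i < m \<and> i \<in> E} = card E"
proof -
  have "{i. i < m \<and> i \<in> E} = E" using assms by auto
  then show ?thesis by simp
qed

lemma submatrix_carrier:
  assumes "G \<in> carrier_mat m m" and "E \<subseteq> {..<m}"
  shows "submatrix G E E \<in> carrier_mat (card E) (card E)"
  using assms(1) by (intro carrier_matI) (auto simp: dim_submatrix card_index_subset[OF assms(2)])

lemma submatrix_nth:
  assumes "G \<in> carrier_mat m m" and "E \<subseteq> {..<m}" and "k < card E" and "l < card E"
  shows "submatrix G E E $$ (k, l) = G $$ (pick E k, pick E l)"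
  using assms by (simp add: submatrix_index card_index_subset)

lemma bij_betw_pick:
  assumes "finite E"
  shows "bij_betw (pick E) {..<card E} E"
proof -
  have "inj_on (pick E) {..<card E}"
    by (rule linorder_inj_onI) (auto dest!: pick_mono_le)
  moreover have "pick E ` {..<card E} \<subseteq> E"
    by (auto intro: pick_in_set_le)
  ultimately show ?thesis
    using assms by (simp add: bij_betw_def card_image card_subset_eq)
qed

lemma sum_pick:
  assumes "finite E"
  shows "(\<Sum>k<card E. f (pick E k)) = (\<Sum>j\<in>E. f j)"
  using sum.reindex_bij_betw[OF bij_betw_pick[OF assms]] .

lemma pick_lessThan: "k < m \<Longrightarrow> pick {..<m} k = k"
  using pick_reduce_set[of k m UNIV] by (simp add: pick_UNIV lessThan_def)

text \<open>\<open>pick\<close> inverts counting the smaller elements, and deleting one element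
  lowers this count by one exactly for the elements above it.\<close>

lemma pick_delete:
  assumes fin: "finite E" and k: "k < card E" and l: "l < card E - 1"
  shows "pick (E - {pick E k}) l = pick E (if l < k then l else Suc l)"
proof -
  define a where "a = pick E (if l < k then l else Suc l)"
  have lt: "(if l < k then l else Suc l) < card E" using k l by auto
  have aE: "a \<in> E" unfolding a_def by (rule pick_in_set_le[OF lt])
  have ca: "card {b\<in>E. b < a} = (if l < k then l else Suc l)"
    unfolding a_def by (rule card_pick_le[OF lt])
  have pk: "pick E k \<in> E" by (rule pick_in_set_le[OF k])
  have "card {b \<in> E - {pick E k}. b < a} = l" and "a \<noteq> pick E k"
  proof -
    show "a \<noteq> pick E k" using ca card_pick_le[OF k] by (auto split: if_splits)
    show "card {b \<in> E - {pick E k}. b < a} = l"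
    proof (cases "l < k")
      case True
      then have "a < pick E k" unfolding a_def using pick_mono_le[OF k] by simp
      then have "{b \<in> E - {pick E k}. b < a} = {b\<in>E. b < a}" by auto
      with ca True show ?thesis by simp
    next
      case False
      then have "pick E k < a" unfolding a_def using lt pick_mono_le[of "Suc l" E k] by simp
      then have "{b \<in> E - {pick E k}. b < a} = {b\<in>E. b < a} - {pick E k}"
        and "pick E k \<in> {b\<in>E. b < a}" using pk by auto
      with ca False fin show ?thesis by simp
    qed
  qed
  with aE have "pick (E - {pick E k}) l = a"
    using pick_card_in_set[of a "E - {pick E k}"] by simp
  then show ?thesis unfolding a_def .
qed

lemma mat_delete_submatrix:
  assumes G: "G \<in> carrier_mat m m" and E: "E \<subseteq> {..<m}" and k: "k < card E"
  shows "mat_delete (submatrix G E E) k k = submatrix G (E - {pick E k}) (E - {pick E k})"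
proof -
  have fin: "finite E" using E finite_subset by blast
  have E': "E - {pick E k} \<subseteq> {..<m}" using E by auto
  have c: "card (E - {pick E k}) = card E - 1"
    using fin pick_in_set_le[OF k] by simp
  note S = submatrix_carrier[OF G E] and S' = submatrix_carrier[OF G E', unfolded c]
  show ?thesis
  proof (rule eq_matI, goal_cases)
    case (1 i j)
    with S' have ij: "i < card E - 1" "j < card E - 1" by auto
    then show ?case
      using S k by (simp add: mat_delete_def submatrix_nth[OF G E] submatrix_nth[OF G E', unfolded c]
          pick_delete[OF fin k])
  qed (use S S' in auto)
qed

section \<open>Linear systems with a principal submatrix\<close>

lemma submatrix_mult_vec:
  assumes G: "G \<in> carrier_mat m m" and E: "E \<subseteq> {..<m}"
  shows "submatrix G E E *\<^sub>v vec (card E) (\<lambda>k. y (pick E k)) =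
    vec (card E) (\<lambda>k. \<Sum>j\<in>E. G $$ (pick E k, j) * y j)"
proof (rule eq_vecI, goal_cases)
  case (1 k)
  have fin: "finite E" using E finite_subset by blast
  from 1 have k: "k < card E" by simp
  have "(submatrix G E E *\<^sub>v vec (card E) (\<lambda>k. y (pick E k))) $ k =
     (\<Sum>l<card E. G $$ (pick E k, pick E l) * y (pick E l))"
    using k submatrix_carrier[OF G E]
    by (auto simp: scalar_prod_def submatrix_nth[OF G E] lessThan_atLeast0 intro!: sum.cong)
  also have "\<dots> = (\<Sum>j\<in>E. G $$ (pick E k, j) * y j)"
    by (rule sum_pick[OF fin])
  finally show ?case using k by simp
qed (use submatrix_carrier[OF G E] in auto)

text \<open>Cramer's rule without division, so that singular submatrices are covered: the adjugate
  is applied to \<open>S v = t e_k\<close>, and entry \<open>k\<close>, where \<open>v\<close> is 1,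
  leaves \<open>t\<close> times the diagonal cofactor at \<open>k\<close>.\<close>

lemma det_submatrix_remove:
  fixes G :: "'a :: idom mat"
  assumes G: "G \<in> carrier_mat m m" and E: "E \<subseteq> {..<m}" and i: "i \<in> E" and zi: "z i = 1"
    and z0: "\<And>k. k \<in> E - {i} \<Longrightarrow> (\<Sum>j\<in>E. G $$ (k, j) * z j) = 0"
  shows "det (submatrix G E E) =
    (\<Sum>j\<in>E. G $$ (i, j) * z j) * det (submatrix G (E - {i}) (E - {i}))"
proof -
  have fin: "finite E" using E finite_subset by blast
  define S where "S = submatrix G E E"
  define n where "n = card E"
  define t where "t = (\<Sum>j\<in>E. G $$ (i, j) * z j)"
  have img: "pick E ` {..<n} = E"
    using bij_betw_pick[OF fin] by (simp add: bij_betw_def n_def)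
  have inj: "inj_on (pick E) {..<n}"
    using bij_betw_pick[OF fin] by (simp add: bij_betw_def n_def)
  from i have "i \<in> pick E ` {..<n}" unfolding img .
  then obtain k where k: "k < n" and ik: "pick E k = i" by (elim imageE) simp
  have S: "S \<in> carrier_mat n n" unfolding S_def n_def by (rule submatrix_carrier[OF G E])
  define v where "v = vec n (\<lambda>k. z (pick E k))"
  have Sv: "S *\<^sub>v v = t \<cdot>\<^sub>v unit_vec n k"
  proof -
    have "S *\<^sub>v v = vec n (\<lambda>k. \<Sum>j\<in>E. G $$ (pick E k, j) * z j)"
      unfolding S_def v_def n_def by (rule submatrix_mult_vec[OF G E])
    also have "\<dots> = t \<cdot>\<^sub>v unit_vec n k"
    proof (rule eq_vecI, goal_cases)
      case (1 l)
      then have l: "l < n" by simp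
      show ?case
      proof (cases "l = k")
        case True
        then show ?thesis using k ik by (simp add: t_def)
      next
        case False
        then have "pick E l \<in> E - {i}"
          using l k img inj_on_eq_iff[OF inj, of l k] ik by auto
        then show ?thesis using l k False by (simp add: z0)
      qed
    qed auto
    finally show ?thesis .
  qed
  have v: "v \<in> carrier_vec n" by (simp add: v_def)
  note adj = adj_mat[OF S]
  have "det S \<cdot>\<^sub>v v = (det S \<cdot>\<^sub>m 1\<^sub>m n) *\<^sub>v v" using v by auto
  also have "\<dots> = adj_mat S *\<^sub>v (S *\<^sub>v v)"
    using adj S v by (metis assoc_mult_mat_vec)
  also have "\<dots> = t \<cdot>\<^sub>v col (adj_mat S) k"
    unfolding Sv using adj(1) k by (auto simp: mult_mat_vec)
  finally have "(det S \<cdot>\<^sub>v v) $ k = (t \<cdot>\<^sub>v col (adj_mat S) k) $ k" by simp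
  then have "det S = t * cofactor S k k"
    using k adj(1) S by (auto simp: v_def ik zi adj_mat_def)
  then show ?thesis
    using mat_delete_submatrix[OF G E, of k] k
    by (simp add: cofactor_def S_def t_def ik n_def flip: mult_2)
qed

text \<open>Padding the solution by zeros to a function on all indices lets solutions for different
  sets \<open>E\<close> be subtracted.\<close>

lemma submatrix_inverse_solves:
  fixes G :: "'a :: field mat"
  assumes G: "G \<in> carrier_mat m m" and E: "E \<subseteq> {..<m}" and det: "det (submatrix G E E) \<noteq> 0"
  obtains y where "\<And>j. j \<notin> E \<Longrightarrow> y j = 0"
    and "\<And>i. i \<in> E \<Longrightarrow> (\<Sum>j\<in>E. G $$ (i, j) * y j) = q i"
    and "the (mat_inverse (submatrix G E E)) *\<^sub>v vec (card E) (\<lambda>k. q (pick E k)) =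
      vec (card E) (\<lambda>k. y (pick E k))"
proof -
  have fin: "finite E" using E finite_subset by blast
  define S where "S = submatrix G E E"
  define n where "n = card E"
  have S: "S \<in> carrier_mat n n" unfolding S_def n_def by (rule submatrix_carrier[OF G E])
  obtain B where B: "mat_inverse S = Some B"
    using mat_inverse(1)[OF S, of undefined] det_non_zero_imp_unit[OF S det[folded S_def], of undefined]
    by (cases "mat_inverse S") auto
  from mat_inverse(2)[OF S B] have SB: "S * B = 1\<^sub>m n" and Bc: "B \<in> carrier_mat n n" by auto
  define w where "w = vec n (\<lambda>k. q (pick E k))"
  \<comment> \<open>The number of elements of \<open>E\<close> below \<open>j\<close> is the
    position of \<open>j\<close> in \<open>E\<close>; this inverts \<open>pick E\<close>.\<close>
  define y where "y j = (if j \<in> E then (B *\<^sub>v w) $ card {a\<in>E. a < j} else 0)" for j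
  have w: "w \<in> carrier_vec n" by (simp add: w_def)
  have Bw: "B *\<^sub>v w = vec n (\<lambda>k. y (pick E k))"
    using Bc by (intro eq_vecI) (auto simp: y_def n_def pick_in_set_le card_pick_le)
  have "vec n (\<lambda>k. \<Sum>j\<in>E. G $$ (pick E k, j) * y j) = S *\<^sub>v (B *\<^sub>v w)"
    unfolding Bw unfolding S_def n_def submatrix_mult_vec[OF G E] ..
  also have "\<dots> = w"
    using assoc_mult_mat_vec[OF S Bc w] SB w by simp
  finally have eq: "vec n (\<lambda>k. \<Sum>j\<in>E. G $$ (pick E k, j) * y j) = vec n (\<lambda>k. q (pick E k))"
    unfolding w_def .
  show thesis
  proof
    show "y j = 0" if "j \<notin> E" for j using that by (simp add: y_def)
    show "the (mat_inverse (submatrix G E E)) *\<^sub>v vec (card E) (\<lambda>k. q (pick E k)) =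
      vec (card E) (\<lambda>k. y (pick E k))"
      using B Bw by (simp add: S_def w_def n_def)
    fix i assume "i \<in> E"
    then have "i \<in> pick E ` {..<n}"
      using bij_betw_pick[OF fin] by (simp add: bij_betw_def n_def)
    then obtain k where "k < n" "pick E k = i" by blast
    then show "(\<Sum>j\<in>E. G $$ (i, j) * y j) = q i"
      using arg_cong[OF eq, of "\<lambda>v. v $ k"] by simp
  qed
qed

section \<open>Singular K-matrices\<close>

locale K_dagger =
  fixes m :: nat and G :: "real mat"
  assumes carrier: "G \<in> carrier_mat m m" and K_dagger: "K_dagger_matrix G"
begin

definition lin :: "(nat \<Rightarrow> real) \<Rightarrow> nat \<Rightarrow> real" where
  "lin y i = (\<Sum>j<m. G $$ (i, j) * y j)"

lemma lin_diff: "lin (\<lambda>j. y j - z j) i = lin y i - lin z i"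
  by (simp add: lin_def right_diff_distrib sum_subtractf)

lemma lin_scale: "lin (\<lambda>j. c * y j) i = c * lin y i"
  by (simp add: lin_def sum_distrib_left mult.left_commute)

lemma lin_support:
  assumes "E \<subseteq> {..<m}" and "\<And>j. j \<notin> E \<Longrightarrow> y j = 0"
  shows "lin y i = (\<Sum>j\<in>E. G $$ (i, j) * y j)"
  unfolding lin_def using assms by (intro sum.mono_neutral_right) auto

lemma off_diagonal:
  assumes "i < m" and "j < m" and "i \<noteq> j"
  shows "G $$ (i, j) \<le> 0"
  using K_dagger carrier assms by (auto simp: K_dagger_matrix_def Z_matrix_def)

text \<open>Where \<open>d\<close> vanishes, the diagonal entry drops out of the row and only
  non-positive entries of \<open>G\<close> contribute.\<close>

lemma lin_nonpos:
  assumes "i < m" and "d i = 0" and "\<And>j. j < m \<Longrightarrow> d j \<ge> 0"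
  shows "lin d i \<le> 0"
  unfolding lin_def
proof (rule sum_nonpos)
  fix j assume "j \<in> {..<m}"
  then show "G $$ (i, j) * d j \<le> 0"
    using assms off_diagonal by (cases "j = i") (auto simp: mult_nonpos_nonneg)
qed

lemma lin_nonneg:
  assumes "i < m" and "d i = 0" and "\<And>j. j < m \<Longrightarrow> d j \<le> 0"
  shows "lin d i \<ge> 0"
  using lin_nonpos[of i "\<lambda>j. -1 * d j"] lin_scale[of "-1" d i] assms by simp

section \<open>Determinants and inverse positivity of principal submatrices\<close>

lemma det_principal_pos:
  assumes "E \<subset> {..<m}"
  shows "det (submatrix G E E) > 0"
proof (cases "E = {}")
  case True
  then have "submatrix G E E \<in> carrier_mat 0 0"
    using submatrix_carrier[OF carrier, of E] by simp
  then show ?thesis by (simp add: det_dim_zero)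
next
  case False
  then show ?thesis
    using K_dagger carrier assms by (auto simp: K_dagger_matrix_def P_dagger_matrix_def)
qed

lemma det_principal_nonneg:
  assumes "E \<subseteq> {..<m}"
  shows "det (submatrix G E E) \<ge> 0"
proof (cases "E = {..<m}")
  case True
  have "submatrix G {..<m} {..<m} = G"
    using carrier submatrix_carrier[OF carrier, of "{..<m}"]
    by (intro eq_matI) (auto simp: submatrix_nth[OF carrier] pick_lessThan)
  then show ?thesis
    using True K_dagger by (simp add: K_dagger_matrix_def P_dagger_matrix_def)
next
  case False
  with assms show ?thesis by (intro less_imp_le det_principal_pos) auto
qed

lemma lin_solvable:
  assumes "E \<subset> {..<m}"
  obtains y where "\<And>j. j \<notin> E \<Longrightarrow> y j = 0" and "\<And>i. i \<in> E \<Longrightarrow> lin y i = q i"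
proof -
  have sub: "E \<subseteq> {..<m}" and det: "det (submatrix G E E) \<noteq> 0"
    using assms det_principal_pos[OF assms] by auto
  obtain y where "\<And>j. j \<notin> E \<Longrightarrow> y j = 0"
    and "\<And>i. i \<in> E \<Longrightarrow> (\<Sum>j\<in>E. G $$ (i, j) * y j) = q i"
    using submatrix_inverse_solves[OF carrier sub det] by metis
  then show thesis using that[of y] lin_support[OF sub, of y] by simp
qed

text \<open>If \<open>d\<close> vanishes off \<open>E\<close>, this is the usual monotonicity of a
  principal submatrix. Non-negative entries off \<open>E\<close> are allowed because differences of
  solutions for different sets have them.\<close>

definition inverse_positive :: "nat set \<Rightarrow> bool" where
  "inverse_positive E \<longleftrightarrow> (\<forall>d. (\<forall>j<m. j \<notin> E \<longrightarrow> d j \<ge> 0) \<longrightarrow> (\<forall>i\<in>E. lin d i \<ge> 0) \<longrightarrow>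
     (\<forall>j<m. d j \<ge> 0))"

text \<open>The number \<^term>\<open>lin z i\<close> is the Schur complement of the principal submatrix on E
  in the one on \<^term>\<open>insert i E\<close>.\<close>

lemma schur_vector:
  assumes pos: "inverse_positive E" and E: "E \<subset> {..<m}" and i: "i < m" "i \<notin> E"
  obtains z where "z i = 1" and "\<And>j. j < m \<Longrightarrow> z j \<ge> 0"
    and "\<And>j. j \<notin> insert i E \<Longrightarrow> z j = 0" and "\<And>k. k \<in> E \<Longrightarrow> lin z k = 0"
    and "lin z i \<ge> 0" and "insert i E \<subset> {..<m} \<Longrightarrow> lin z i > 0"
proof -
  obtain y where y0: "\<And>j. j \<notin> E \<Longrightarrow> y j = 0" and y: "\<And>k. k \<in> E \<Longrightarrow> lin y k = - G $$ (k, i)"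
    using lin_solvable[OF E, of "\<lambda>k. - G $$ (k, i)"] by blast
  \<comment> \<open>On the rows in \<open>E\<close> the vector \<open>y\<close> cancels column
    \<open>i\<close> of \<open>G\<close>, so the entry 1 at \<open>i\<close> makes
    \<open>lin z\<close> vanish there.\<close>
  define z where "z = y(i := 1)"
  have supp: "z j = 0" if "j \<notin> insert i E" for j using that y0 by (simp add: z_def)
  have "lin z k = lin y k + G $$ (k, i)" for k
  proof -
    have "lin z k = (\<Sum>j<m. G $$ (k, j) * y j + (if j = i then G $$ (k, i) else 0))"
      unfolding lin_def using y0[OF i(2)] by (intro sum.cong) (auto simp: z_def)
    then show ?thesis using i by (simp add: sum.distrib lin_def)
  qed
  then have z_E: "lin z k = 0" if "k \<in> E" for k using y[OF that] by simp
  have z_nonneg: "z j \<ge> 0" if "j < m" for j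
  proof -
    have "\<forall>j<m. j \<notin> E \<longrightarrow> z j \<ge> 0" using y0 by (simp add: z_def)
    moreover have "\<forall>k\<in>E. lin z k \<ge> 0" using z_E by simp
    ultimately show ?thesis using pos that unfolding inverse_positive_def by blast
  qed
  have sub: "insert i E \<subseteq> {..<m}" using E i by auto
  have "det (submatrix G (insert i E) (insert i E)) = lin z i * det (submatrix G E E)"
  proof -
    have "lin z k = (\<Sum>j\<in>insert i E. G $$ (k, j) * z j)" for k
      by (rule lin_support[OF sub supp])
    moreover have "insert i E - {i} = E" and "z i = 1" using i by (auto simp: z_def)
    ultimately show ?thesis
      using det_submatrix_remove[OF carrier sub, of i z] z_E by simp
  qed
  \<comment> \<open>The Schur complement is a quotient of principal minors; it can vanish only if
    \<open>insert i E\<close> is the full set.\<close>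
  moreover note det_principal_pos[OF E] det_principal_nonneg[OF sub]
  ultimately have "lin z i \<ge> 0" and "insert i E \<subset> {..<m} \<Longrightarrow> lin z i > 0"
    using det_principal_pos[of "insert i E"] by (auto simp: zero_le_mult_iff zero_less_mult_iff)
  then show thesis using that[of z] supp z_E z_nonneg by (simp add: z_def)
qed

text \<open>By induction, the Schur vector \<open>z\<close> eliminating the new index
  \<open>i\<close>: \<open>d - d i * z\<close> vanishes at \<open>i\<close> and is non-negative by
  the induction hypothesis, so row \<open>i\<close> of its image is non-positive. Hence
  \<open>d i * lin z i\<close> is non-negative, and \<open>lin z i\<close> is positive because
  \<open>insert i E\<close> is proper.\<close>

lemma inverse_positive_proper:
  assumes "E \<subset> {..<m}"
  shows "inverse_positive E"
proof -
  have "finite E" using assms finite_subset by blast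
  then show ?thesis using assms
  proof (induction E rule: finite_induct)
    case empty
    then show ?case by (simp add: inverse_positive_def)
  next
    case (insert i E)
    then have E: "E \<subset> {..<m}" and im: "i < m" by auto
    have pos: "inverse_positive E" by (rule insert.IH[OF E])
    obtain z where z: "z i = 1" "\<And>j. j < m \<Longrightarrow> z j \<ge> 0"
      "\<And>k. k \<in> E \<Longrightarrow> lin z k = 0" "lin z i > 0"
      and supp: "\<And>j. j \<notin> insert i E \<Longrightarrow> z j = 0"
      using schur_vector[OF pos E im insert.hyps(2)] insert.prems by metis
    show ?case unfolding inverse_positive_def
    proof (intro allI impI)
      fix d j assume off: "\<forall>j<m. j \<notin> insert i E \<longrightarrow> 0 \<le> d j"
        and on: "\<forall>k\<in>insert i E. 0 \<le> lin d k" and j: "j < m"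
      define d' where "d' j = d j - d i * z j" for j
      have lin': "lin d' k = lin d k - d i * lin z k" for k
        unfolding d'_def by (simp add: lin_diff lin_scale)
      have "\<forall>j<m. j \<notin> E \<longrightarrow> d' j \<ge> 0"
      proof (intro allI impI)
        fix j assume "j < m" "j \<notin> E"
        then show "d' j \<ge> 0" using off supp[of j] by (cases "j = i") (auto simp: d'_def z(1))
      qed
      moreover have "\<forall>k\<in>E. lin d' k \<ge> 0" using on by (simp add: lin' z(3))
      ultimately have d': "d' j \<ge> 0" if "j < m" for j
        using pos that unfolding inverse_positive_def by blast
      have "lin d' i \<le> 0" using d' im z(1) by (intro lin_nonpos) (auto simp: d'_def)
      then have "d i * lin z i \<ge> 0" using on by (simp add: lin')
      then have "d i \<ge> 0" using z(4) by (simp add: zero_le_mult_iff)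
      then show "d j \<ge> 0" using d'[OF j] z(2)[OF j] by (simp add: d'_def)
        (smt (verit) mult_nonneg_nonneg)
    qed
  qed
qed

lemma nonneg_of_lin_nonneg:
  assumes "E \<subset> {..<m}" and "\<And>j. j < m \<Longrightarrow> j \<notin> E \<Longrightarrow> d j \<ge> 0"
    and "\<And>i. i \<in> E \<Longrightarrow> lin d i \<ge> 0" and "j < m"
  shows "d j \<ge> 0"
  using inverse_positive_proper[OF assms(1)] assms(2-) unfolding inverse_positive_def by blast

lemma nonpos_of_lin_nonpos:
  assumes "E \<subset> {..<m}" and "\<And>j. j < m \<Longrightarrow> j \<notin> E \<Longrightarrow> d j \<le> 0"
    and "\<And>i. i \<in> E \<Longrightarrow> lin d i \<le> 0" and "j < m"
  shows "d j \<le> 0"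
  using nonneg_of_lin_nonneg[OF assms(1), of "\<lambda>j. -1 * d j" j] lin_scale[of "-1" d] assms(2-)
  by simp

end

section \<open>Equilibrium exercise sets\<close>

locale K_dagger_colsum = K_dagger +
  assumes colsum: "j < m \<Longrightarrow> (\<Sum>i<m. G $$ (i, j)) \<ge> 0"
begin

lemma sum_lin: "(\<Sum>i<m. lin d i) = (\<Sum>j<m. (\<Sum>i<m. G $$ (i, j)) * d j)"
  unfolding lin_def sum_distrib_right by (rule sum.swap)

text \<open>Summing the rows weights \<open>d j\<close> by the sum of column \<open>j\<close>; the
  hypothesis on column sums enters here.\<close>

lemma sum_lin_nonpos:
  assumes "\<And>j. j < m \<Longrightarrow> d j \<le> 0"
  shows "(\<Sum>i<m. lin d i) \<le> 0"
  unfolding sum_lin using assms colsum by (intro sum_nonpos) (simp add: mult_nonneg_nonpos)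

end

text \<open>\<open>Y\<close> is constrained at proper subsets only: \<open>G\<close> may be
  singular, and then the full system need not be solvable.\<close>

locale exercise_game = K_dagger_colsum +
  fixes q :: "nat \<Rightarrow> real" and Y :: "nat set \<Rightarrow> nat \<Rightarrow> real"
  assumes Y_support: "E \<subset> {..<m} \<Longrightarrow> j \<notin> E \<Longrightarrow> Y E j = 0"
    and Y_solves: "E \<subset> {..<m} \<Longrightarrow> i \<in> E \<Longrightarrow> lin (Y E) i = q i"
begin

text \<open>The payoff minus P when exactly the players in E exercise.\<close>

definition gain :: "nat set \<Rightarrow> nat \<Rightarrow> real" where
  "gain E i = (if E = {..<m} then q i else lin (Y E) i)"

text \<open>Any number of players may switch at once. This implies the Nash property: if one player
  switches, the others do not lose and the total does not rise, so the switcher does not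
  gain.\<close>

definition equilibrium :: "nat set \<Rightarrow> bool" where
  "equilibrium E \<longleftrightarrow> E \<subseteq> {..<m} \<and> (\<forall>F \<subseteq> {..<m}.
     (\<forall>i<m. (i \<in> E \<longleftrightarrow> i \<in> F) \<longrightarrow> gain E i \<le> gain F i) \<and>
     (\<Sum>i<m. gain F i) \<le> (\<Sum>i<m. gain E i))"

lemma gain_exercise: "F \<subseteq> {..<m} \<Longrightarrow> i \<in> F \<Longrightarrow> gain F i = q i"
  using Y_solves[of F i] by (auto simp: gain_def)

text \<open>The hypotheses make \<open>Y E\<close> a solution of the linear complementarity problem
  for \<open>G\<close> and \<open>q\<close>. For proper \<open>F\<close>, the difference
  \<open>Y F - Y E\<close> is non-positive off \<open>F\<close>, where \<open>Y F\<close> vanishes,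
  and its image is non-positive on \<open>F\<close>, where \<open>lin (Y F)\<close> is
  \<open>q\<close>; inverse positivity on \<open>F\<close> makes it non-positive throughout.\<close>

lemma complementary_equilibrium:
  assumes E: "E \<subset> {..<m}" and nonneg: "\<And>j. j < m \<Longrightarrow> Y E j \<ge> 0"
    and wait: "\<And>i. i < m \<Longrightarrow> i \<notin> E \<Longrightarrow> q i \<le> lin (Y E) i"
  shows "equilibrium E"
proof -
  have gE: "gain E = lin (Y E)" using E by (auto simp: gain_def)
  have q_le: "q i \<le> lin (Y E) i" if "i < m" for i
    using wait[OF that] Y_solves[OF E, of i] by (cases "i \<in> E") auto
  have "((i \<in> E \<longleftrightarrow> i \<in> F) \<longrightarrow> gain E i \<le> gain F i) \<and> (\<Sum>i<m. gain F i) \<le> (\<Sum>i<m. gain E i)"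
    if F: "F \<subseteq> {..<m}" and i: "i < m" for F i
  proof (cases "F = {..<m}")
    case True
    \<comment> \<open>If all exercise, each gets \<open>q\<close>, a lower bound for the gains under
      \<open>E\<close>; those who keep their choice lie in \<open>E\<close> and get \<open>q\<close>
      both times.\<close>
    then have gF: "gain F = q" by (auto simp: gain_def)
    show ?thesis
      unfolding gF gE using q_le i True Y_solves[OF E, of i] by (auto intro: sum_mono)
  next
    case False
    with F have F': "F \<subset> {..<m}" by auto
    then have gF: "gain F = lin (Y F)" by (auto simp: gain_def)
    define d where "d j = Y F j - Y E j" for j
    have lin_d: "lin d k = lin (Y F) k - lin (Y E) k" for k
      unfolding d_def by (rule lin_diff)
    have d: "d j \<le> 0" if "j < m" for j
    proof (rule nonpos_of_lin_nonpos[OF F' _ _ that])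
      show "d j \<le> 0" if "j < m" "j \<notin> F" for j
        using that nonneg by (simp add: d_def Y_support[OF F'])
      show "lin d k \<le> 0" if "k \<in> F" for k
        using that F q_le[of k] by (auto simp: lin_d Y_solves[OF F'])
    qed
    have "(\<Sum>i<m. lin (Y F) i) \<le> (\<Sum>i<m. lin (Y E) i)"
      using sum_lin_nonpos[of d] d by (simp add: lin_d sum_subtractf)
    moreover have "lin (Y E) i \<le> lin (Y F) i" if "i \<in> E \<longleftrightarrow> i \<in> F"
    proof (cases "i \<in> E")
      case True
      with that show ?thesis by (simp add: Y_solves[OF E] Y_solves[OF F'])
    next
      case False
      with that have "d i = 0" by (simp add: d_def Y_support[OF E] Y_support[OF F'])
      from lin_nonneg[of i d, OF i this d] show ?thesis by (simp add: lin_d)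
    qed
    ultimately show ?thesis by (simp add: gF gE)
  qed
  \<comment> \<open>The bound on totals was shown for a fixed \<open>i < m\<close>, so the game
    without players is treated apart.\<close>
  then show ?thesis using E unfolding equilibrium_def
    by (cases "m = 0") auto
qed

text \<open>If all players but i exercise optimally and i prefers to exercise as well, then adding a
  multiple of the Schur vector z replaces the possibly missing solution for the full set.\<close>

lemma full_equilibrium:
  assumes E: "E \<subset> {..<m}" and nonneg: "\<And>j. j < m \<Longrightarrow> Y E j \<ge> 0"
    and i: "i < m" "i \<notin> E" and full: "insert i E = {..<m}" and less: "lin (Y E) i < q i"
  shows "equilibrium {..<m}"
proof -
  have gM: "gain {..<m} = q" by (auto simp: gain_def)
  obtain z where z: "z i = 1" "\<And>j. j < m \<Longrightarrow> z j \<ge> 0"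
      "\<And>k. k \<in> E \<Longrightarrow> lin z k = 0" "lin z i \<ge> 0"
    using schur_vector[OF inverse_positive_proper[OF E] E i] by metis
  have sum_split: "(\<Sum>k<m. f k) = f i + (\<Sum>k\<in>E. f k)" for f :: "nat \<Rightarrow> real"
    unfolding full[symmetric] using i E finite_subset[of E "{..<m}"] by simp
  have total: "(\<Sum>k<m. gain F k) \<le> (\<Sum>k<m. q k)" if F': "F \<subset> {..<m}" for F
  proof -
    define d where "d j = Y F j - Y E j" for j
    \<comment> \<open>Since \<open>z i = 1\<close>, this turns entry \<open>i\<close> of
      \<open>d'\<close> into \<open>min (d i) 0\<close>.\<close>
    define lam where "lam = max (d i) 0"
    define d' where "d' j = d j - lam * z j" for j
    have lin_d: "lin d k = lin (Y F) k - lin (Y E) k" for k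
      unfolding d_def by (rule lin_diff)
    have lin_d': "lin d' k = lin d k - lam * lin z k" for k
      unfolding d'_def by (simp add: lin_diff lin_scale)
    have d': "d' j \<le> 0" if "j < m" for j
    \<comment> \<open>Index \<open>i\<close> is left out because \<open>lin d i\<close> is positive
      if \<open>i\<close> is in \<open>F\<close>; entry \<open>i\<close> is controlled by
      \<open>lam\<close> instead.\<close>
    proof (rule nonpos_of_lin_nonpos[of "F - {i}", OF _ _ _ that])
      show "F - {i} \<subset> {..<m}" using F' by auto
      show "d' j \<le> 0" if "j < m" "j \<notin> F - {i}" for j
      proof (cases "j = i")
        case True
        then show ?thesis by (simp add: d'_def z lam_def)
      next
        case False
        with that have "d j \<le> 0" using nonneg[of j] by (simp add: d_def Y_support[OF F'])
        moreover have "lam * z j \<ge> 0" using z(2)[of j] that by (simp add: lam_def)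
        ultimately show ?thesis by (simp add: d'_def)
      qed
      show "lin d' k \<le> 0" if "k \<in> F - {i}" for k
      proof -
        have "k \<in> E" using that F' full by auto
        then show ?thesis using that
          by (simp add: lin_d' lin_d z Y_solves[OF E] Y_solves[OF F'])
      qed
    qed
    \<comment> \<open>If \<open>lam\<close> is positive, then \<open>i\<close> is in
      \<open>F\<close> and \<open>d'\<close> vanishes at \<open>i\<close>, so row \<open>i\<close>
      of its image is non-negative, while \<open>lin d i\<close> is
      \<open>q i - lin (Y E) i\<close>.\<close>
    have bound: "lam * lin z i \<le> q i - lin (Y E) i"
    proof (cases "d i \<le> 0")
      case True
      then show ?thesis using less by (simp add: lam_def)
    next
      case False
      then have "i \<in> F" using Y_support[OF F', of i] Y_support[OF E i(2)] by (auto simp: d_def)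
      moreover have "d' i = 0" using False by (simp add: d'_def lam_def z)
      then have "lin d' i \<ge> 0" using lin_nonneg[OF i(1)] d' by blast
      ultimately show ?thesis by (simp add: lin_d' lin_d Y_solves[OF F'])
    qed
    have "(\<Sum>k<m. lin z k) = lin z i" by (simp add: sum_split z)
    then have "(\<Sum>k<m. lin d' k) = (\<Sum>k<m. lin (Y F) k) - (\<Sum>k<m. lin (Y E) k) - lam * lin z i"
      by (simp add: lin_d' lin_d sum_subtractf flip: sum_distrib_left)
    with sum_lin_nonpos[of d', OF d'] bound
    have "(\<Sum>k<m. lin (Y F) k) \<le> (\<Sum>k<m. lin (Y E) k) + (q i - lin (Y E) i)" by simp
    also have "\<dots> = (\<Sum>k<m. q k)" by (simp add: sum_split Y_solves[OF E])
    finally show ?thesis using F' by (simp add: gain_def psubset_eq)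
  qed
  have "(\<Sum>k<m. gain F k) \<le> (\<Sum>k<m. q k)" if "F \<subseteq> {..<m}" for F
    using total[of F] that gM by (cases "F = {..<m}") auto
  \<comment> \<open>A player agreeing with the full set exercises in \<open>F\<close> as well and
    gets \<open>q\<close> both times.\<close>
  then show ?thesis
    unfolding equilibrium_def gM by (simp add: gain_exercise)
qed

text \<open>If \<open>i\<close> outside \<open>E\<close> prefers to exercise,
  \<open>Y (insert i E) - Y E\<close> has zero image on \<open>E\<close>, positive image at
  \<open>i\<close> and zero entries elsewhere. For proper \<open>insert i E\<close> it is thus
  non-negative, against the maximality of \<open>E\<close>.\<close>

lemma equilibrium_exists: "\<exists>E. equilibrium E"
proof (cases "m = 0")
  \<comment> \<open>Without players there is no proper subset to start from.\<close>
  case True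
  then have "equilibrium {}" unfolding equilibrium_def by simp
  then show ?thesis ..
next
  case False
  define A where "A = {E. E \<subset> {..<m} \<and> (\<forall>j<m. Y E j \<ge> 0)}"
  have "finite A" by (rule finite_subset[of _ "Pow {..<m}"]) (auto simp: A_def)
  moreover have "{} \<in> A"
  proof -
    have "{} \<subset> {..<m}" using False by auto
    then show ?thesis using Y_support[of "{}"] by (simp add: A_def)
  qed
  ultimately obtain E where EA: "E \<in> A" and max: "\<And>F. F \<in> A \<Longrightarrow> E \<subseteq> F \<Longrightarrow> E = F"
    using finite_has_maximal[of A] by (metis empty_iff)
  have E: "E \<subset> {..<m}" and nonneg: "\<And>j. j < m \<Longrightarrow> Y E j \<ge> 0" using EA by (auto simp: A_def)
  show ?thesis
  proof (cases "\<forall>i<m. i \<notin> E \<longrightarrow> q i \<le> lin (Y E) i")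
    case True
    with complementary_equilibrium[OF E nonneg] show ?thesis by blast
  next
    case False
    then obtain i where i: "i < m" "i \<notin> E" and less: "lin (Y E) i < q i" by auto
    let ?F = "insert i E"
    have "?F = {..<m}"
    proof (rule ccontr)
      assume "?F \<noteq> {..<m}"
      then have F: "?F \<subset> {..<m}" using E i by auto
      define d where "d j = Y ?F j - Y E j" for j
      have lin_d: "lin d k = lin (Y ?F) k - lin (Y E) k" for k
        unfolding d_def by (rule lin_diff)
      have "d j \<ge> 0" if "j < m" for j
      proof (rule nonneg_of_lin_nonneg[OF F _ _ that])
        show "d j \<ge> 0" if "j < m" "j \<notin> ?F" for j
          using that by (simp add: d_def Y_support[OF F] Y_support[OF E])
        show "lin d k \<ge> 0" if "k \<in> ?F" for k
          using that less by (auto simp: lin_d Y_solves[OF E] Y_solves[OF F])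
      qed
      then have "Y ?F j \<ge> 0" if "j < m" for j
        using that nonneg[OF that] by (fastforce simp: d_def)
      with F have "?F \<in> A" by (simp add: A_def)
      with max[of ?F] i show False by auto
    qed
    with full_equilibrium[OF E nonneg i _ less] show ?thesis by blast
  qed
qed

end

section \<open>Coalition values\<close>

text \<open>\<open>a0\<close> guarantees \<open>v\<close> and \<open>b0\<close> caps the payoff at
  \<open>v\<close>, so maximin and minimax meet there. Finiteness bounds the suprema and
  infima.\<close>

lemma saddle_point_value:
  fixes f :: "'a \<Rightarrow> 'b \<Rightarrow> real"
  assumes fin: "finite A" "finite B" and mem: "a0 \<in> A" "b0 \<in> B"
    and low: "\<And>b. b \<in> B \<Longrightarrow> v \<le> f a0 b" and up: "\<And>a. a \<in> A \<Longrightarrow> f a b0 \<le> v"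
  shows "(SUP a\<in>A. INF b\<in>B. f a b) = v" and "(INF b\<in>B. SUP a\<in>A. f a b) = v"
proof -
  have f0: "f a0 b0 = v" using low[OF mem(2)] up[OF mem(1)] by simp
  have inf_le: "(INF b\<in>B. f a b) \<le> f a b0" for a
    using fin mem by (intro cINF_lower) auto
  have le_sup: "f a0 b \<le> (SUP a\<in>A. f a b)" for b
    using fin mem by (intro cSUP_upper) auto
  show "(SUP a\<in>A. INF b\<in>B. f a b) = v"
  proof (rule antisym)
    show "(SUP a\<in>A. INF b\<in>B. f a b) \<le> v"
      using mem up inf_le by (intro cSUP_least) (auto intro: order_trans)
    have "v \<le> (INF b\<in>B. f a0 b)" using mem low by (intro cINF_greatest) auto
    also have "\<dots> \<le> (SUP a\<in>A. INF b\<in>B. f a b)"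
      using fin mem by (intro cSUP_upper) auto
    finally show "v \<le> (SUP a\<in>A. INF b\<in>B. f a b)" .
  qed
  show "(INF b\<in>B. SUP a\<in>A. f a b) = v"
  proof (rule antisym)
    have "(INF b\<in>B. SUP a\<in>A. f a b) \<le> (SUP a\<in>A. f a b0)"
      using fin mem by (intro cINF_lower) auto
    also have "\<dots> \<le> v" using mem up by (intro cSUP_least) auto
    finally show "(INF b\<in>B. SUP a\<in>A. f a b) \<le> v" .
    show "v \<le> (INF b\<in>B. SUP a\<in>A. f a b)"
      using mem low le_sup by (intro cINF_greatest) (auto intro: order_trans)
  qed
qed

lemma exercise_set_subset: "exercise_set m s \<subseteq> {..<m}"
  by (auto simp: exercise_set_def)

text \<open>One formula serves all players: for those in \<open>E\<close> the sum is
  \<open>X $ i - P $ i\<close>, and for empty \<open>E\<close> it is 0.\<close>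

lemma payoff_exercise_set:
  assumes G: "G \<in> carrier_mat m m" and X: "X \<in> carrier_vec m" and P: "P \<in> carrier_vec m"
    and E: "E \<subset> {..<m}" and det: "det (submatrix G E E) \<noteq> 0"
  obtains y where "\<And>j. j \<notin> E \<Longrightarrow> y j = 0"
    and "\<And>i. i \<in> E \<Longrightarrow> (\<Sum>j\<in>E. G $$ (i, j) * y j) = X $ i - P $ i"
    and "\<And>s i. exercise_set m s = E \<Longrightarrow> i < m \<Longrightarrow>
      payoff m X P G s i = P $ i + (\<Sum>j\<in>E. G $$ (i, j) * y j)"
proof -
  have sub: "E \<subseteq> {..<m}" and fin: "finite E" using E finite_subset by auto
  obtain y where y0: "\<And>j. j \<notin> E \<Longrightarrow> y j = 0"
    and y: "\<And>i. i \<in> E \<Longrightarrow> (\<Sum>j\<in>E. G $$ (i, j) * y j) = X $ i - P $ i"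
    and inv: "the (mat_inverse (submatrix G E E)) *\<^sub>v
        vec (card E) (\<lambda>k. X $ pick E k - P $ pick E k) = vec (card E) (\<lambda>k. y (pick E k))"
    using submatrix_inverse_solves[OF G sub det, of "\<lambda>i. X $ i - P $ i"] by blast
  have sv: "subvec X E - subvec P E = vec (card E) (\<lambda>k. X $ pick E k - P $ pick E k)"
    using X P by (auto simp: subvec_def card_index_subset[OF sub])
  have "payoff m X P G s i = P $ i + (\<Sum>j\<in>E. G $$ (i, j) * y j)"
    if s: "exercise_set m s = E" and i: "i < m" for s i
  proof (cases "i \<in> E")
    case True
    then show ?thesis using s y by (simp add: payoff_def Let_def)
  next
    case False
    have pm: "pick E k < m" if "k < card E" for k using pick_in_set_le[OF that] sub by auto
    have "subvec (row G i) E \<bullet> vec (card E) (\<lambda>k. y (pick E k)) =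
      (\<Sum>k<card E. G $$ (i, pick E k) * y (pick E k))"
      using G i pm by (simp add: subvec_def card_index_subset[OF sub] scalar_prod_def lessThan_atLeast0)
    also have "\<dots> = (\<Sum>j\<in>E. G $$ (i, j) * y j)" by (rule sum_pick[OF fin])
    finally show ?thesis using False s sv inv by (simp add: payoff_def Let_def)
  qed
  with y0 y show thesis using that by blast
qed

theorem theorem3p2:
  fixes m :: nat and X P :: "real vec" and G :: "real mat" and N :: "nat set"
  assumes "affine_game m X P G"
    and "K_dagger_matrix G"
    and "\<forall>j<m. (\<Sum>i<m. G $$ (i, j)) \<ge> 0"
    and "N \<subseteq> {..<m}"
  shows "coalition_value_exists m X P G N \<and>
         coalition_value m X P G N = (\<Sum>i\<in>N. coalition_value m X P G {i})"
proof -
  have G: "G \<in> carrier_mat m m" and X: "X \<in> carrier_vec m" and P: "P \<in> carrier_vec m"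
    using assms(1) by (auto simp: affine_game_def)
  interpret K_dagger_colsum m G
    using G assms(2,3) by unfold_locales auto
  define q where "q i = X $ i - P $ i" for i
  \<comment> \<open>The implication under the quantifier allows a choice of \<open>Y\<close> for all
    \<open>E\<close> at once.\<close>
  have "\<exists>y. E \<subset> {..<m} \<longrightarrow> (\<forall>j. j \<notin> E \<longrightarrow> y j = 0) \<and> (\<forall>i\<in>E. lin y i = q i) \<and>
      (\<forall>s i. exercise_set m s = E \<longrightarrow> i < m \<longrightarrow> payoff m X P G s i = P $ i + lin y i)" for E
  proof (cases "E \<subset> {..<m}")
    case True
    then have sub: "E \<subseteq> {..<m}" and det: "det (submatrix G E E) \<noteq> 0"
      using det_principal_pos[OF True] by auto
    obtain y where y0: "\<And>j. j \<notin> E \<Longrightarrow> y j = 0"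
      and "\<And>i. i \<in> E \<Longrightarrow> (\<Sum>j\<in>E. G $$ (i, j) * y j) = X $ i - P $ i"
      and "\<And>s i. exercise_set m s = E \<Longrightarrow> i < m \<Longrightarrow>
        payoff m X P G s i = P $ i + (\<Sum>j\<in>E. G $$ (i, j) * y j)"
      using payoff_exercise_set[OF G X P True det] by blast
    then show ?thesis by (intro exI[of _ y]) (simp add: lin_support[OF sub y0] q_def)
  qed simp
  then obtain Y where Y: "\<And>E. E \<subset> {..<m} \<Longrightarrow> (\<forall>j. j \<notin> E \<longrightarrow> Y E j = 0) \<and> (\<forall>i\<in>E. lin (Y E) i = q i) \<and>
      (\<forall>s i. exercise_set m s = E \<longrightarrow> i < m \<longrightarrow> payoff m X P G s i = P $ i + lin (Y E) i)"
    by metis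
  interpret exercise_game m G q Y
    using Y by unfold_locales auto
  have payoff: "payoff m X P G s i = P $ i + gain (exercise_set m s) i" if "i < m" for s i
    using Y[of "exercise_set m s"] that exercise_set_subset[of m s]
    by (cases "exercise_set m s = {..<m}") (auto simp: gain_def payoff_def q_def psubset_eq)
  obtain E where "equilibrium E" using equilibrium_exists by blast
  then have E: "E \<subseteq> {..<m}"
    and stay: "\<And>F i. F \<subseteq> {..<m} \<Longrightarrow> i < m \<Longrightarrow> (i \<in> E \<longleftrightarrow> i \<in> F) \<Longrightarrow> gain E i \<le> gain F i"
    and total: "\<And>F. F \<subseteq> {..<m} \<Longrightarrow> (\<Sum>i<m. gain F i) \<le> (\<Sum>i<m. gain E i)"
    unfolding equilibrium_def by blast+
  define s :: "nat \<Rightarrow> nat" where "s i = (if i \<in> E then 0 else 1)" for i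
  \<comment> \<open>\<open>w\<close> does not depend on the coalition, whence additivity.\<close>
  define w where "w i = P $ i + gain E i" for i
  have coalition: "lower_value m X P G N = sum w N" "upper_value m X P G N = sum w N"
    if N: "N \<subseteq> {..<m}" for N
  proof -
    let ?A = "strategies N" and ?B = "strategies ({..<m} - N)"
    define ex where "ex a b = exercise_set m (combine N a b)" for a b
    have ex: "ex a b \<subseteq> {..<m}" for a b unfolding ex_def by (rule exercise_set_subset)
    have cp: "coalition_payoff m X P G N (combine N a b) = (\<Sum>i\<in>N. P $ i + gain (ex a b) i)" for a b
      unfolding coalition_payoff_def ex_def using N by (intro sum.cong) (auto simp: payoff)
    have finN: "finite N" using N finite_subset by blast
    have low: "sum w N \<le> coalition_payoff m X P G N (combine N (restrict s N) b)" if "b \<in> ?B" for b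
      unfolding cp w_def
    proof (rule sum_mono)
      fix i assume "i \<in> N"
      then show "P $ i + gain E i \<le> P $ i + gain (ex (restrict s N) b) i"
        using N by (intro add_left_mono stay[OF ex])
          (auto simp: ex_def exercise_set_def combine_def s_def)
    qed
    have up: "coalition_payoff m X P G N (combine N a (restrict s ({..<m} - N))) \<le> sum w N"
      if "a \<in> ?A" for a
    proof -
      \<comment> \<open>The opponents stay with \<open>E\<close> and do not lose, so the bound on
        the total caps the coalition.\<close>
      let ?F = "ex a (restrict s ({..<m} - N))"
      have "(\<Sum>i\<in>{..<m} - N. gain E i) \<le> (\<Sum>i\<in>{..<m} - N. gain ?F i)"
        by (intro sum_mono stay[OF ex]) (auto simp: ex_def exercise_set_def combine_def s_def)
      moreover note total[OF ex, of a "restrict s ({..<m} - N)"]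
      moreover have "(\<Sum>i<m. f i) = (\<Sum>i\<in>{..<m} - N. f i) + (\<Sum>i\<in>N. f i)" for f :: "nat \<Rightarrow> real"
        by (rule sum.subset_diff[OF N]) simp
      ultimately have "(\<Sum>i\<in>N. gain ?F i) \<le> (\<Sum>i\<in>N. gain E i)" by (smt (verit))
      then show ?thesis unfolding cp w_def by (simp add: sum.distrib)
    qed
    have fin: "finite ?A" "finite ?B"
      unfolding strategies_def using finN by (auto intro!: finite_PiE)
    have mem: "restrict s N \<in> ?A" "restrict s ({..<m} - N) \<in> ?B"
      by (auto simp: strategies_def s_def)
    show "lower_value m X P G N = sum w N" "upper_value m X P G N = sum w N"
      unfolding lower_value_def upper_value_def
      using saddle_point_value[OF fin mem, of "sum w N"
          "\<lambda>a b. coalition_payoff m X P G N (combine N a b)"] low up by blast+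
  qed
  have "coalition_value m X P G {i} = w i" if "i \<in> N" for i
    using coalition(1)[of "{i}"] that assms(4) by (auto simp: coalition_value_def)
  then show ?thesis
    using coalition[OF assms(4)] by (simp add: coalition_value_exists_def coalition_value_def)
qed

end
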